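(* For every $n=0,1,2,\dots$ the monomial $z^n$ satisfies $$\|z^n\|_{\mathcal H}^2=\eta_n:=\int_0^{\infty}\frac{t^n}{(1+t)^2}e^{-t}\,dt\leq n!.$$ Moreover, $\langle z^n,z^m\rangle_{\mathcal H}=0$ for all $n\neq m$ in $\mathbb N=\{0,1,2,\dots\}$.
   Context: $\mathcal H$ denotes the Hörmander-Fock space: the space of entire functions $g:\mathbb C\to\mathbb C$ with $\|g\|_{\mathcal H}^2:=\frac1\pi\int_{\mathbb C}\frac{|g(z)|^2}{(1+|z|^2)^2}e^{-|z|^2}\,d\lambda(z)<\infty$, where $d\lambda$ is Lebesgue measure on $\mathbb C\cong\mathbb R^2$, with inner product $\langle u,v\rangle_{\mathcal H}:=\frac1\pi\int_{\mathbb C}\frac{u(z)\overline{v(z)}}{(1+|z|^2)^2}e^{-|z|^2}\,d\lambda(z)$. *)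

theory Defs
  imports "HOL-Analysis.Analysis"
begin

definition hf_weight :: "complex \<Rightarrow> real" where
  "hf_weight z = exp (- (cmod z)\<^sup>2) / (1 + (cmod z)\<^sup>2)\<^sup>2"

text \<open>The condition that the norm is finite is integrability of the nonnegative integrand, since
  the Bochner integral of a nonintegrable function is 0.\<close>

definition hormander_fock :: "(complex \<Rightarrow> complex) set" where
  "hormander_fock =
     {g. g holomorphic_on UNIV \<and> integrable lborel (\<lambda>z. (cmod (g z))\<^sup>2 * hf_weight z)}"

definition hf_norm :: "(complex \<Rightarrow> complex) \<Rightarrow> real" where
  "hf_norm g = sqrt ((1 / pi) * (\<integral>z. (cmod (g z))\<^sup>2 * hf_weight z \<partial>lborel))"

definition hf_inner :: "(complex \<Rightarrow> complex) \<Rightarrow> (complex \<Rightarrow> complex) \<Rightarrow> complex" where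
  "hf_inner u v =
     (1 / of_real pi) * (\<integral>z. u z * cnj (v z) * of_real (hf_weight z) \<partial>lborel)"

definition hf_eta_integrand :: "nat \<Rightarrow> real \<Rightarrow> real" where
  "hf_eta_integrand n t = t ^ n / (1 + t)\<^sup>2 * exp (- t)"

definition hf_eta :: "nat \<Rightarrow> real" where
  "hf_eta n = (LINT t:{0..}|lborel. hf_eta_integrand n t)"

end

theory Submission
  imports Defs "HOL-Probability.Distributions"
begin

text \<open>The image of Lebesgue measure on the plane under \<open>z \<mapsto> |z|\<^sup>2\<close> is \<open>\<pi>\<close> times Lebesgue
  measure on the half-line, because the disc \<open>|z|\<^sup>2 < s\<close> has area \<open>\<pi> s\<close>; this turns the norm
  of a monomial into the integral defining \<open>\<eta>\<^sub>n\<close> without polar coordinates, and dropping the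
  denominator leaves the Gamma integral \<open>n!\<close>. Orthogonality follows from rotation invariance:
  a rotation by \<open>w\<close> with \<open>|w| = 1\<close> multiplies \<open>\<langle>z\<^sup>n, z\<^sup>m\<rangle>\<close> by \<open>w\<^sup>n\<close> times the conjugate of \<open>w\<^sup>m\<close>,
  and \<open>w\<close> can be chosen so that this factor is not 1.\<close>

section \<open>Lebesgue measure on the plane and the squared modulus\<close>

text \<open>The sign makes the preimage of each half-line \<open>{x<..}\<close> a bounded disc. Both
  measures are then finite on these half-lines, as \<open>measure_eqI_lessThan\<close>
  requires.\<close>

lemma distr_lborel_neg_cmod_power2:
  "distr lborel borel (\<lambda>z. - (cmod z)\<^sup>2) = density lborel (\<lambda>t. ennreal pi * indicator {..0} t)"
    (is "?M = ?N")
proof -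
  have M: "emeasure ?M {x<..} = ennreal (pi * max 0 (- x))" for x
  proof -
    have "emeasure ?M {x<..} = emeasure lborel {z. x < - (cmod z)\<^sup>2}"
      by (subst emeasure_distr) (auto simp: vimage_def)
    \<comment> \<open>For \<open>x\<close> \<ge> 0 the set is empty; the \<open>max\<close> makes
      the radius 0, and the open ball of radius 0 is empty too.\<close>
    also have "{z. x < - (cmod z)\<^sup>2} = ball 0 (sqrt (max 0 (- x)))"
    proof (cases "x < 0")
      case True
      have "x < - (cmod z)\<^sup>2 \<longleftrightarrow> cmod z < sqrt (- x)" for z
      proof -
        have "x < - (cmod z)\<^sup>2 \<longleftrightarrow> sqrt ((cmod z)\<^sup>2) < sqrt (- x)"
          unfolding real_sqrt_less_iff by linarith
        then show ?thesis by (simp only: real_sqrt_abs abs_norm_cancel)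
      qed
      then have "{z. x < - (cmod z)\<^sup>2} = {z. cmod z < sqrt (- x)}"
        by (intro Collect_cong)
      also have "\<dots> = ball 0 (sqrt (max 0 (- x)))"
        using True by (simp add: ball_def max_def)
      finally show ?thesis .
    next
      case False
      then have "\<not> x < - (cmod z)\<^sup>2" for z
        using zero_le_power2[of "cmod z"] by linarith
      with False show ?thesis by (auto simp: max_def)
    qed
    also have "emeasure lborel \<dots> = ennreal (pi * max 0 (- x))"
      by (subst emeasure_ball) (simp_all add: unit_ball_vol_2)
    finally show ?thesis .
  qed
  have N: "emeasure ?N {x<..} = ennreal (pi * max 0 (- x))" for x
  proof -
    have "emeasure ?N {x<..} = (\<integral>\<^sup>+t. ennreal pi * indicator {x<..0} t \<partial>lborel)"
      by (subst emeasure_density) (auto intro!: nn_integral_cong split: split_indicator)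
    also have "\<dots> = ennreal pi * emeasure lborel {x<..0}"
      by (subst nn_integral_cmult_indicator) auto
    also have "\<dots> = ennreal pi * ennreal (max 0 (- x))"
      by (cases "x \<le> 0") (auto simp: max_def)
    also have "\<dots> = ennreal (pi * max 0 (- x))"
      by (rule ennreal_mult [symmetric]) auto
    finally show ?thesis .
  qed
  show ?thesis
    by (rule measure_eqI_lessThan)
       (simp_all only: M N sets_distr sets_density sets_lborel ennreal_less_top infinity_ennreal_def)
qed

text \<open>Polar coordinates for radial integrands: writing \<open>f t\<close> as
  \<open>f (- (- t))\<close> brings in the image measure above, and the reflection of the line
  removes the sign again.\<close>

lemma nn_integral_cmod_power2:
  assumes [measurable]: "f \<in> borel_measurable borel"
  shows "(\<integral>\<^sup>+z. f ((cmod z)\<^sup>2) \<partial>lborel) = ennreal pi * (\<integral>\<^sup>+t. f t * indicator {0..} t \<partial>lborel)"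
proof -
  have "(\<integral>\<^sup>+z. f ((cmod z)\<^sup>2) \<partial>lborel)
      = (\<integral>\<^sup>+t. f (- t) \<partial>distr lborel borel (\<lambda>z. - (cmod z)\<^sup>2))"
    by (subst nn_integral_distr) auto
  also have "\<dots> = (\<integral>\<^sup>+t. ennreal pi * (indicator {..0} t * f (- t)) \<partial>lborel)"
    unfolding distr_lborel_neg_cmod_power2
    by (subst nn_integral_density) (auto simp: mult.assoc)
  also have "\<dots> = ennreal pi * (\<integral>\<^sup>+t. indicator {..0} t * f (- t) \<partial>lborel)"
    by (subst nn_integral_cmult) auto
  also have "(\<integral>\<^sup>+t. indicator {..0} t * f (- t) \<partial>lborel)
      = (\<integral>\<^sup>+t. f t * indicator {0..} t \<partial>lborel)"
    by (subst nn_integral_real_affine[where c = "-1" and t = 0])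
       (auto intro!: nn_integral_cong split: split_indicator)
  finally show ?thesis .
qed

section \<open>Invariance under orthogonal maps and rotations\<close>

text \<open>Both sides, multiplied by the volume of the unit ball \<open>B\<close>, are the double integral of
  \<open>1\<^sub>A(x) 1\<^sub>B(f y - x)\<close> evaluated in the two orders; \<open>f\<close> preserves \<open>B\<close>, and \<open>B = -B\<close>.\<close>

lemma distr_lborel_orthogonal_transformation:
  fixes f :: "'a::euclidean_space \<Rightarrow> 'a"
  assumes f: "orthogonal_transformation f"
  shows "distr lborel borel f = lborel"
proof (rule measure_eqI)
  have "linear f" using f by (rule orthogonal_transformation_linear)
  then have [measurable]: "f \<in> borel_measurable borel"
    by (intro borel_measurable_continuous_onI linear_continuous_on)
       (simp add: linear_conv_bounded_linear)
  obtain g where fg: "\<And>x. f (g x) = x"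
    using orthogonal_transformation_surj[OF f] by (metis surjD)
  have norm_f: "norm (f x) = norm x" for x
    using f by (rule orthogonal_transformation_norm)
  let ?B = "indicator (ball 0 1) :: 'a \<Rightarrow> ennreal"
  have [measurable]: "?B \<in> borel_measurable borel"
    by (intro borel_measurable_indicator) simp
  have B_norm: "?B x = ?B y" if "norm x = norm y" for x y
    using that by (simp add: indicator_def)
  have translate: "(\<integral>\<^sup>+x. h (a + x) \<partial>lborel) = (\<integral>\<^sup>+x. h x \<partial>lborel)"
    if [measurable]: "h \<in> borel_measurable borel" for h :: "'a \<Rightarrow> ennreal" and a
    by (subst (2) lborel_distr_plus[of a, symmetric]) (simp add: nn_integral_distr)
  let ?v = "emeasure lborel (ball 0 1 :: 'a set)"
  fix A assume "A \<in> sets (distr lborel borel f)"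
  then have [measurable]: "A \<in> sets borel" by simp
  have "?v * emeasure lborel A = (\<integral>\<^sup>+x. ?v * indicator A x \<partial>lborel)"
    by (simp add: nn_integral_cmult_indicator)
  also have "\<dots> = (\<integral>\<^sup>+x. \<integral>\<^sup>+y. ?B (f y - x) * indicator A x \<partial>lborel \<partial>lborel)"
  proof (rule nn_integral_cong)
    fix x
    \<comment> \<open>Pulling \<open>x\<close> back through \<open>f\<close> turns the integrand in
      \<open>y\<close> into the indicator of the unit ball centred at \<open>g x\<close>, which has
      volume \<open>?v\<close> by translation invariance.\<close>
    have "norm (f y - x) = norm (- g x + y)" for y
    proof -
      have "f y - x = f (- g x + y)"
        using \<open>linear f\<close> by (simp add: linear_diff fg)
      then show ?thesis by (simp add: norm_f)
    qed
    then have "(\<integral>\<^sup>+y. ?B (f y - x) \<partial>lborel) = (\<integral>\<^sup>+y. ?B (- g x + y) \<partial>lborel)"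
      by (intro nn_integral_cong B_norm)
    also have "\<dots> = ?v" by (subst translate) simp_all
    finally show "?v * indicator A x = (\<integral>\<^sup>+y. ?B (f y - x) * indicator A x \<partial>lborel)"
      by (subst nn_integral_multc) auto
  qed
  also have "\<dots> = (\<integral>\<^sup>+y. \<integral>\<^sup>+x. ?B (f y - x) * indicator A x \<partial>lborel \<partial>lborel)"
    by (rule lborel_pair.Fubini'[symmetric]) measurable
  also have "\<dots> = (\<integral>\<^sup>+y. \<integral>\<^sup>+x. ?B x * indicator A (f y + x) \<partial>lborel \<partial>lborel)"
  proof (rule nn_integral_cong)
    fix y
    \<comment> \<open>Translating \<open>x\<close> by \<open>f y\<close> leaves \<open>- x\<close>
      as the argument of \<open>?B\<close>, and the ball is symmetric.\<close>
    have "(\<integral>\<^sup>+x. ?B (f y - x) * indicator A x \<partial>lborel)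
        = (\<integral>\<^sup>+x. ?B (f y - (f y + x)) * indicator A (f y + x) \<partial>lborel)"
      by (rule translate[symmetric]) measurable
    also have "\<dots> = (\<integral>\<^sup>+x. ?B x * indicator A (f y + x) \<partial>lborel)"
      by (intro nn_integral_cong arg_cong2[where f = "(*)"] B_norm) auto
    finally show "(\<integral>\<^sup>+x. ?B (f y - x) * indicator A x \<partial>lborel)
        = (\<integral>\<^sup>+x. ?B x * indicator A (f y + x) \<partial>lborel)" .
  qed
  also have "\<dots> = (\<integral>\<^sup>+x. \<integral>\<^sup>+y. ?B x * indicator A (f y + x) \<partial>lborel \<partial>lborel)"
    by (rule lborel_pair.Fubini') measurable
  also have "\<dots> = (\<integral>\<^sup>+x. ?B x * emeasure (distr lborel borel f) A \<partial>lborel)"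
  proof (rule nn_integral_cong)
    fix x
    \<comment> \<open>The shift by \<open>x\<close> after \<open>f\<close> is a shift by
      \<open>g x\<close> before it, which the integral over \<open>y\<close> absorbs.\<close>
    have "(\<integral>\<^sup>+y. indicator A (f y + x) \<partial>lborel) = (\<integral>\<^sup>+y. indicator A (f (g x + y)) \<partial>lborel)"
      using \<open>linear f\<close> by (simp add: linear_add fg add.commute)
    also have "\<dots> = (\<integral>\<^sup>+y. indicator A (f y) \<partial>lborel)"
      by (rule translate) measurable
    also have "\<dots> = (\<integral>\<^sup>+y. indicator A y \<partial>distr lborel borel f)"
      by (subst nn_integral_distr) auto
    also have "\<dots> = emeasure (distr lborel borel f) A" by simp
    finally show "(\<integral>\<^sup>+y. ?B x * indicator A (f y + x) \<partial>lborel)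
        = ?B x * emeasure (distr lborel borel f) A"
      by (subst nn_integral_cmult) auto
  qed
  also have "\<dots> = ?v * emeasure (distr lborel borel f) A"
    by (subst nn_integral_multc) auto
  finally have eq: "?v * emeasure lborel A = ?v * emeasure (distr lborel borel f) A" .
  \<comment> \<open>The unit ball has positive finite volume, so \<open>?v\<close> can be cancelled
    in \<open>ennreal\<close>.\<close>
  have "?v = ennreal (unit_ball_vol DIM('a))"
    by (subst emeasure_ball) auto
  then have "?v \<noteq> 0" "?v \<noteq> \<infinity>" by (auto simp: ennreal_eq_0_iff not_le)
  with eq show "emeasure (distr lborel borel f) A = emeasure lborel A"
    by (simp add: ennreal_mult_cancel_left)
qed simp

lemma orthogonal_transformation_cmult:
  fixes w :: complex
  assumes "cmod w = 1"
  shows "orthogonal_transformation ((*) w)"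
  unfolding orthogonal_transformation
  using assms by (auto simp: norm_mult bounded_linear_mult_right bounded_linear.linear)

lemma integral_lborel_rotate:
  fixes h :: "complex \<Rightarrow> complex" and w :: complex
  assumes "cmod w = 1" and [measurable]: "h \<in> borel_measurable borel"
  shows "(\<integral>z. h (w * z) \<partial>lborel) = (\<integral>z. h z \<partial>lborel)"
proof -
  have "(\<integral>z. h (w * z) \<partial>lborel) = (\<integral>z. h z \<partial>distr lborel borel ((*) w))"
    by (subst integral_distr) auto
  then show ?thesis
    by (simp add: distr_lborel_orthogonal_transformation orthogonal_transformation_cmult assms)
qed

section \<open>The integrals \<eta> and the norms of the monomials\<close>

lemma cmod_power_hf_weight_eq: "(cmod (z ^ n))\<^sup>2 * hf_weight z = hf_eta_integrand n ((cmod z)\<^sup>2)"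
  by (simp add: hf_weight_def hf_eta_integrand_def norm_power power_mult[symmetric] mult.commute)

lemma hf_eta_integrand_nonneg: "0 \<le> t \<Longrightarrow> 0 \<le> hf_eta_integrand n t"
  by (simp add: hf_eta_integrand_def)

lemma borel_measurable_hf_eta_integrand [measurable]: "hf_eta_integrand n \<in> borel_measurable borel"
  unfolding hf_eta_integrand_def [abs_def] by measurable

lemma borel_measurable_hf_weight [measurable]: "hf_weight \<in> borel_measurable borel"
  unfolding hf_weight_def [abs_def] by measurable

text \<open>On the half-line the denominator is at least 1. Bounding the nonnegative integral yields
  both integrability and, later, the bound on \<open>hf_eta n\<close>.\<close>

lemma nn_integral_hf_eta_integrand_le:
  "(\<integral>\<^sup>+t. ennreal (hf_eta_integrand n t) * indicator {0..} t \<partial>lborel) \<le> ennreal (fact n)"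
proof -
  have "hf_eta_integrand n t \<le> t ^ n * exp (- t)" if "0 \<le> t" for t
  proof -
    have "t ^ n / (1 + t)\<^sup>2 \<le> t ^ n / 1"
      using that by (intro divide_left_mono) (auto simp: one_le_power)
    then show ?thesis
      unfolding hf_eta_integrand_def by (intro mult_right_mono) auto
  qed
  then have "(\<integral>\<^sup>+t. ennreal (hf_eta_integrand n t) * indicator {0..} t \<partial>lborel)
      \<le> (\<integral>\<^sup>+t. ennreal (t ^ n * exp (- t)) * indicator {0..} t \<partial>lborel)"
    by (intro nn_integral_mono) (auto split: split_indicator intro!: ennreal_leI)
  also have "\<dots> = ennreal (fact n)"
    using nn_intergal_power_times_exp_Ici[of n] by simp
  finally show ?thesis .
qed

text \<open>A nonnegative measurable function with finite nonnegative integral is integrable, so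
  \<open>hf_eta n\<close> is the true value of the integral and not the default 0.\<close>

lemma
  shows set_integrable_hf_eta_integrand: "set_integrable lborel {0..} (hf_eta_integrand n)"
    and nn_integral_hf_eta_integrand:
      "(\<integral>\<^sup>+t. ennreal (hf_eta_integrand n t) * indicator {0..} t \<partial>lborel) = ennreal (hf_eta n)"
    and hf_eta_nonneg: "0 \<le> hf_eta n"
proof -
  have ind: "ennreal (indicator {0..} t *\<^sub>R hf_eta_integrand n t)
      = ennreal (hf_eta_integrand n t) * indicator {0..} t" for t
    by (auto split: split_indicator)
  have nonneg: "0 \<le> indicator {0..} t *\<^sub>R hf_eta_integrand n t" for t
    by (auto split: split_indicator intro: hf_eta_integrand_nonneg)
  show int: "set_integrable lborel {0..} (hf_eta_integrand n)"
    unfolding set_integrable_def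
  proof (rule integrableI_nonneg)
    show "(\<integral>\<^sup>+t. ennreal (indicator {0..} t *\<^sub>R hf_eta_integrand n t) \<partial>lborel) < \<infinity>"
      unfolding ind using nn_integral_hf_eta_integrand_le[of n] by (rule order.strict_trans1) simp
  qed (use nonneg in auto)
  show "(\<integral>\<^sup>+t. ennreal (hf_eta_integrand n t) * indicator {0..} t \<partial>lborel) = ennreal (hf_eta n)"
    unfolding hf_eta_def set_lebesgue_integral_def ind [symmetric]
    using int nonneg unfolding set_integrable_def by (intro nn_integral_eq_integral) auto
  show "0 \<le> hf_eta n"
    unfolding hf_eta_def set_lebesgue_integral_def by (intro integral_nonneg_AE AE_I2 nonneg)
qed

lemma hf_eta_le_fact: "hf_eta n \<le> fact n"
  using nn_integral_hf_eta_integrand_le[of n] by (simp add: nn_integral_hf_eta_integrand)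

text \<open>The integrand is radial, so the plane integral reduces to the half-line. This form
  carries both integrability, for membership in the space, and the value, for the norm.\<close>

lemma has_bochner_integral_cmod_power_hf_weight:
  "has_bochner_integral lborel (\<lambda>z. (cmod (z ^ n))\<^sup>2 * hf_weight z) (pi * hf_eta n)"
  unfolding cmod_power_hf_weight_eq
proof (rule has_bochner_integral_nn_integral)
  show "(\<integral>\<^sup>+z. ennreal (hf_eta_integrand n ((cmod z)\<^sup>2)) \<partial>lborel) = ennreal (pi * hf_eta n)"
    by (subst nn_integral_cmod_power2)
       (simp_all add: nn_integral_hf_eta_integrand ennreal_mult hf_eta_nonneg)
qed (auto intro!: AE_I2 hf_eta_integrand_nonneg mult_nonneg_nonneg hf_eta_nonneg)

section \<open>Orthogonality of the monomials\<close>

lemma hf_inner_power_eq_0: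
  assumes "n \<noteq> m"
  shows "hf_inner (\<lambda>z. z ^ n) (\<lambda>z. z ^ m) = 0"
proof -
  \<comment> \<open>The angle is chosen so that the factor becomes \<open>cis 1\<close> whatever
    \<open>n\<close> and \<open>m\<close> are; the difference is taken in the reals because it may
    be negative.\<close>
  define w where "w = cis (1 / (real n - real m))"
  have w: "cmod w = 1" by (simp add: w_def)
  have "w ^ n * cnj (w ^ m)
      = cis (real n * (1 / (real n - real m)) - real m * (1 / (real n - real m)))"
    by (simp add: w_def cis_cnj Complex.DeMoivre cis_mult)
  also have "real n * (1 / (real n - real m)) - real m * (1 / (real n - real m)) = 1"
    using assms unfolding left_diff_distrib [symmetric] by simp
  finally have "w ^ n * cnj (w ^ m) = cis 1" .
  \<comment> \<open>The imaginary part \<open>sin 1\<close> is positive, since 0 < 1 <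
    \<pi>.\<close>
  moreover have "cis 1 \<noteq> 1"
    using sin_gt_zero[of 1] pi_gt3 by (auto simp: complex_eq_iff)
  ultimately have w_ne: "w ^ n * cnj (w ^ m) \<noteq> 1" by simp
  let ?h = "\<lambda>z. z ^ n * cnj (z ^ m) * of_real (hf_weight z)"
  have "(\<integral>z. ?h z \<partial>lborel) = (\<integral>z. ?h (w * z) \<partial>lborel)"
  proof (intro integral_lborel_rotate[symmetric, OF w] borel_measurable_times)
    show "(\<lambda>z. cnj (z ^ m)) \<in> borel_measurable borel"
      by (intro borel_measurable_continuous_onI continuous_intros)
    show "(\<lambda>z. complex_of_real (hf_weight z)) \<in> borel_measurable borel"
      by (rule measurable_compose[OF borel_measurable_hf_weight])
         (intro borel_measurable_continuous_onI continuous_intros)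
  qed simp
  \<comment> \<open>The weight depends on the modulus alone, so only the two powers contribute a
    factor.\<close>
  also have "\<dots> = (\<integral>z. (w ^ n * cnj (w ^ m)) * ?h z \<partial>lborel)"
    by (simp add: hf_weight_def norm_mult w power_mult_distrib mult_ac)
  also have "\<dots> = (w ^ n * cnj (w ^ m)) * (\<integral>z. ?h z \<partial>lborel)"
    by (rule integral_mult_right_zero)
  finally have "(\<integral>z. ?h z \<partial>lborel) = 0"
    using w_ne by auto
  then show ?thesis by (simp add: hf_inner_def)
qed

theorem proposition3p6:
  shows "(\<forall>n::nat. (\<lambda>z. z ^ n) \<in> hormander_fock
            \<and> set_integrable lborel {0..} (hf_eta_integrand n)
            \<and> (hf_norm (\<lambda>z. z ^ n))\<^sup>2 = hf_eta n
            \<and> hf_eta n \<le> fact n)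
       \<and> (\<forall>n m :: nat. n \<noteq> m \<longrightarrow> hf_inner (\<lambda>z. z ^ n) (\<lambda>z. z ^ m) = 0)"
proof (intro conjI allI impI)
  fix n :: nat
  note int = has_bochner_integral_cmod_power_hf_weight[of n]
  show "(\<lambda>z. z ^ n) \<in> hormander_fock"
    using integrable.intros[OF int]
    by (simp add: hormander_fock_def holomorphic_on_power)
  \<comment> \<open>The \<pi> from the area of the disc cancels the normalisation 1/\<pi> in the
    norm.\<close>
  show "(hf_norm (\<lambda>z. z ^ n))\<^sup>2 = hf_eta n"
    using has_bochner_integral_integral_eq[OF int]
    by (simp add: hf_norm_def hf_eta_nonneg)
qed (auto intro: set_integrable_hf_eta_integrand hf_eta_le_fact hf_inner_power_eq_0)

end
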